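(* Let $n\geq 2$ be an integer. The monadic $\Pi^1_1$-theory of the structure $(\mathbb{R}^n,\beta)$ is $\Pi^1_1$-hard.
   Context: Let $d$ be the Euclidean metric on $\mathbb{R}^n$. The betweenness relation $\beta\subseteq(\mathbb{R}^n)^3$ is defined by $\beta(s,t,u)$ iff $d(s,u)=d(s,t)+d(t,u)$; $(\mathbb{R}^n,\beta)$ is the structure with domain $\mathbb{R}^n$ and this ternary relation. The monadic $\Pi^1_1$-theory of a $\{\beta\}$-structure $\mathfrak{M}$ is the set of sentences of the form $\forall X_1\cdots\forall X_k\,\varphi$, where $X_1,\dots,X_k$ are unary relation variables and $\varphi$ is a first-order sentence of vocabulary $\{\beta,X_1,\dots,X_k\}$, that are true in $\mathfrak{M}$ when the $X_i$ range over all subsets of the domain. Hardness is with respect to computable many-one reductions to the membership problem of this set of sentences. *)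

theory Defs
  imports "HOL-Analysis.Analysis" "HOL-Library.Nat_Bijection"
begin

section \<open>Computable functions and many-one reductions\<close>

text \<open>Codes of partial recursive functions (Kleene). Arities are not tracked syntactically: a code
  whose arity does not fit its argument list either has no value there or ignores arguments.\<close>

datatype recf =
    Rzero
  | Rsucc
  | Rproj nat
  | Rcomp recf "recf list"
  | Rprec recf recf
  | Rmin recf

text \<open>\<open>computes p xs y\<close>: the partial function with code \<open>p\<close> is defined at \<open>xs\<close>, with value \<open>y\<close>.\<close>

inductive computes :: "recf \<Rightarrow> nat list \<Rightarrow> nat \<Rightarrow> bool" where
  zero: "computes Rzero xs 0"
| succ: "computes Rsucc [x] (Suc x)"
| proj: "i < length xs \<Longrightarrow> computes (Rproj i) xs (xs ! i)"
| comp: "length ys = length gs \<Longrightarrow> (\<forall>i<length gs. computes (gs ! i) xs (ys ! i)) \<Longrightarrow>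
    computes f ys z \<Longrightarrow> computes (Rcomp f gs) xs z"
| prec_0: "computes f xs y \<Longrightarrow> computes (Rprec f g) (0 # xs) y"
| prec_Suc: "computes (Rprec f g) (n # xs) r \<Longrightarrow> computes g (n # r # xs) y \<Longrightarrow>
    computes (Rprec f g) (Suc n # xs) y"
| min: "computes f (n # xs) 0 \<Longrightarrow> (\<forall>m<n. \<exists>y. computes f (m # xs) (Suc y)) \<Longrightarrow>
    computes (Rmin f) xs n"

definition computable :: "(nat \<Rightarrow> nat) \<Rightarrow> bool" where
  "computable f \<longleftrightarrow> (\<exists>p. \<forall>x. computes p [x] (f x))"

definition many_one_reducible :: "nat set \<Rightarrow> nat set \<Rightarrow> bool" where
  "many_one_reducible A B \<longleftrightarrow> (\<exists>f. computable f \<and> (\<forall>x. x \<in> A \<longleftrightarrow> f x \<in> B))"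

inductive_cases computes_RzeroE: "computes Rzero xs y"
inductive_cases computes_RsuccE: "computes Rsucc xs y"
inductive_cases computes_RprojE: "computes (Rproj i) xs y"
inductive_cases computes_RcompE: "computes (Rcomp f gs) xs y"
inductive_cases computes_Rprec_0E: "computes (Rprec f g) (0 # xs) y"
inductive_cases computes_Rprec_SucE: "computes (Rprec f g) (Suc n # xs) y"
inductive_cases computes_RminE: "computes (Rmin f) xs y"

lemma computes_functional: "computes p xs y \<Longrightarrow> computes p xs z \<Longrightarrow> y = z"
proof (induction arbitrary: z rule: computes.induct)
  case zero
  then show ?case by (blast elim: computes_RzeroE)
next
  case succ
  then show ?case by (auto elim: computes_RsuccE)
next
  case proj
  from proj.prems show ?case by (rule computes_RprojE) simp
next
  case (comp ys gs xs f w)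
  from comp.prems show ?case
  proof (rule computes_RcompE)
    fix ys' assume ys': "length ys' = length gs"
      "\<forall>i<length gs. computes (gs ! i) xs (ys' ! i)" "computes f ys' z"
    have "ys = ys'"
    proof (rule nth_equalityI)
      show "length ys = length ys'" using comp.hyps ys' by simp
      show "ys ! i = ys' ! i" if "i < length ys" for i
        using that comp.hyps comp.IH(1) ys'(2) by metis
    qed
    then show ?thesis using comp.IH(2) ys'(3) by blast
  qed
next
  case (prec_0 f xs y g)
  from prec_0.prems show ?case by (rule computes_Rprec_0E) (rule prec_0.IH)
next
  case (prec_Suc f g n xs r y)
  from prec_Suc.prems show ?case
    by (rule computes_Rprec_SucE) (metis prec_Suc.IH)
next
  case (min f n xs)
  from min.prems show ?case
  proof (rule computes_RminE)
    assume z: "computes f (z # xs) 0" "\<forall>m<z. \<exists>y. computes f (m # xs) (Suc y)"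
    show ?thesis
    proof (rule linorder_cases[of n z])
      assume "n < z"
      then obtain y where "computes f (n # xs) (Suc y)" using z(2) by blast
      then have "0 = Suc y" by (rule min.IH(1))
      then show ?thesis by simp
    next
      assume "z < n"
      then obtain y where "\<forall>w. computes f (z # xs) w \<longrightarrow> Suc y = w" using min.IH(2) by blast
      then show ?thesis using z(1) by blast
    qed
  qed
qed


section \<open>$\Pi^1_1$ sets of natural numbers\<close>

datatype aterm =
    AVar nat
  | AZero
  | AOne
  | APlus aterm aterm
  | ATimes aterm aterm

text \<open>Arithmetical formulas of second-order arithmetic: only number variables are quantified.
  \<open>AIn t i\<close> says that the number \<open>t\<close> belongs to the value of the \<open>i\<close>-th set variable.\<close>

datatype aform =
    AEq aterm aterm
  | ALess aterm aterm
  | AIn aterm nat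
  | ANot aform
  | AAnd aform aform
  | AEx nat aform

primrec aval :: "(nat \<Rightarrow> nat) \<Rightarrow> aterm \<Rightarrow> nat" where
  "aval e (AVar x) = e x"
| "aval e AZero = 0"
| "aval e AOne = 1"
| "aval e (APlus s t) = aval e s + aval e t"
| "aval e (ATimes s t) = aval e s * aval e t"

primrec asat :: "(nat \<Rightarrow> nat set) \<Rightarrow> (nat \<Rightarrow> nat) \<Rightarrow> aform \<Rightarrow> bool" where
  "asat S e (AEq s t) \<longleftrightarrow> aval e s = aval e t"
| "asat S e (ALess s t) \<longleftrightarrow> aval e s < aval e t"
| "asat S e (AIn t i) \<longleftrightarrow> aval e t \<in> S i"
| "asat S e (ANot \<phi>) \<longleftrightarrow> \<not> asat S e \<phi>"
| "asat S e (AAnd \<phi> \<psi>) \<longleftrightarrow> asat S e \<phi> \<and> asat S e \<psi>"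
| "asat S e (AEx x \<phi>) \<longleftrightarrow> (\<exists>a. asat S (e(x := a)) \<phi>)"

primrec atvars :: "aterm \<Rightarrow> nat set" where
  "atvars (AVar x) = {x}"
| "atvars AZero = {}"
| "atvars AOne = {}"
| "atvars (APlus s t) = atvars s \<union> atvars t"
| "atvars (ATimes s t) = atvars s \<union> atvars t"

primrec afree :: "aform \<Rightarrow> nat set" where
  "afree (AEq s t) = atvars s \<union> atvars t"
| "afree (ALess s t) = atvars s \<union> atvars t"
| "afree (AIn t i) = atvars t"
| "afree (ANot \<phi>) = afree \<phi>"
| "afree (AAnd \<phi> \<psi>) = afree \<phi> \<union> afree \<psi>"
| "afree (AEx x \<phi>) = afree \<phi> - {x}"

text \<open>\<open>A\<close> is defined over the natural numbers by \<open>\<forall>X\<^sub>0 \<dots> \<forall>X\<^sub>m. \<phi>(x)\<close>, where \<open>x\<close> is the number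
  variable \<open>0\<close>. All set variables are quantified, so there are no set parameters (lightface);
  quantifying the infinitely many that do not occur in \<open>\<phi>\<close> is vacuous.\<close>

definition Pi11_set :: "nat set \<Rightarrow> bool" where
  "Pi11_set A \<longleftrightarrow> (\<exists>\<phi>. afree \<phi> \<subseteq> {0} \<and> A = {x. \<forall>S. asat S (\<lambda>_. x) \<phi>})"

definition Pi11_hard :: "nat set \<Rightarrow> bool" where
  "Pi11_hard B \<longleftrightarrow> (\<forall>A. Pi11_set A \<longrightarrow> many_one_reducible A B)"


section \<open>The monadic $\Pi^1_1$-theory of a structure with one ternary relation\<close>

text \<open>First-order formulas over a ternary relation symbol and unary relation variables;
  \<open>FPred i x\<close> is the atom applying the \<open>i\<close>-th relation variable to the first-order variable \<open>x\<close>.\<close>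

datatype form =
    FEq nat nat
  | FBetw nat nat nat
  | FPred nat nat
  | FNot form
  | FAnd form form
  | FEx nat form

primrec fsat :: "('a \<Rightarrow> 'a \<Rightarrow> 'a \<Rightarrow> bool) \<Rightarrow> (nat \<Rightarrow> 'a set) \<Rightarrow> (nat \<Rightarrow> 'a) \<Rightarrow> form \<Rightarrow> bool" where
  "fsat R X e (FEq x y) \<longleftrightarrow> e x = e y"
| "fsat R X e (FBetw x y z) \<longleftrightarrow> R (e x) (e y) (e z)"
| "fsat R X e (FPred i x) \<longleftrightarrow> e x \<in> X i"
| "fsat R X e (FNot \<phi>) \<longleftrightarrow> \<not> fsat R X e \<phi>"
| "fsat R X e (FAnd \<phi> \<psi>) \<longleftrightarrow> fsat R X e \<phi> \<and> fsat R X e \<psi>"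
| "fsat R X e (FEx x \<phi>) \<longleftrightarrow> (\<exists>a. fsat R X (e(x := a)) \<phi>)"

primrec ffree :: "form \<Rightarrow> nat set" where
  "ffree (FEq x y) = {x, y}"
| "ffree (FBetw x y z) = {x, y, z}"
| "ffree (FPred i x) = {x}"
| "ffree (FNot \<phi>) = ffree \<phi>"
| "ffree (FAnd \<phi> \<psi>) = ffree \<phi> \<union> ffree \<psi>"
| "ffree (FEx x \<phi>) = ffree \<phi> - {x}"

primrec fpreds :: "form \<Rightarrow> nat set" where
  "fpreds (FEq x y) = {}"
| "fpreds (FBetw x y z) = {}"
| "fpreds (FPred i x) = {i}"
| "fpreds (FNot \<phi>) = fpreds \<phi>"
| "fpreds (FAnd \<phi> \<psi>) = fpreds \<phi> \<union> fpreds \<psi>"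
| "fpreds (FEx x \<phi>) = fpreds \<phi>"

text \<open>The pair \<open>(k, \<phi>)\<close> stands for the sentence \<open>\<forall>X\<^sub>0 \<dots> \<forall>X\<^sub>k\<^sub>-\<^sub>1. \<phi>\<close>.\<close>

type_synonym mform = "nat \<times> form"

definition mpi11_sentence :: "mform \<Rightarrow> bool" where
  "mpi11_sentence s \<longleftrightarrow> ffree (snd s) = {} \<and> fpreds (snd s) \<subseteq> {..<fst s}"

text \<open>On sentences, the values of \<open>X i\<close> for \<open>i \<ge> k\<close> and the assignment \<open>e\<close> do not matter
  (see \<open>fsat_cong\<close> below).\<close>

definition mtrue :: "('a \<Rightarrow> 'a \<Rightarrow> 'a \<Rightarrow> bool) \<Rightarrow> mform \<Rightarrow> bool" where
  "mtrue R s \<longleftrightarrow> (\<forall>X e. fsat R X e (snd s))"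

definition mpi11_theory :: "('a \<Rightarrow> 'a \<Rightarrow> 'a \<Rightarrow> bool) \<Rightarrow> mform set" where
  "mpi11_theory R = {s. mpi11_sentence s \<and> mtrue R s}"

lemma fsat_cong:
  "(\<And>i. i \<in> fpreds \<phi> \<Longrightarrow> X i = Y i) \<Longrightarrow> (\<And>x. x \<in> ffree \<phi> \<Longrightarrow> e x = e' x) \<Longrightarrow>
    fsat R X e \<phi> \<longleftrightarrow> fsat R Y e' \<phi>"
proof (induction \<phi> arbitrary: e e')
  case (FEx x \<phi>)
  have "fsat R X (e(x := a)) \<phi> \<longleftrightarrow> fsat R Y (e'(x := a)) \<phi>" for a
    using FEx.prems by (intro FEx.IH) auto
  then show ?case by simp
next
  case (FNot \<phi>)
  have "fsat R X e \<phi> \<longleftrightarrow> fsat R Y e' \<phi>"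
    using FNot.prems by (intro FNot.IH) auto
  then show ?case by simp
next
  case (FAnd \<phi> \<psi>)
  have "fsat R X e \<phi> \<longleftrightarrow> fsat R Y e' \<phi>" "fsat R X e \<psi> \<longleftrightarrow> fsat R Y e' \<psi>"
    using FAnd.prems by (auto intro!: FAnd.IH)
  then show ?case by simp
qed auto

text \<open>Goedel numbering.\<close>

primrec fcode :: "form \<Rightarrow> nat" where
  "fcode (FEq x y) = prod_encode (0, prod_encode (x, y))"
| "fcode (FBetw x y z) = prod_encode (1, prod_encode (x, prod_encode (y, z)))"
| "fcode (FPred i x) = prod_encode (2, prod_encode (i, x))"
| "fcode (FNot \<phi>) = prod_encode (3, fcode \<phi>)"
| "fcode (FAnd \<phi> \<psi>) = prod_encode (4, prod_encode (fcode \<phi>, fcode \<psi>))"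
| "fcode (FEx x \<phi>) = prod_encode (5, prod_encode (x, fcode \<phi>))"

definition mcode :: "mform \<Rightarrow> nat" where
  "mcode s = prod_encode (fst s, fcode (snd s))"

lemma fcode_eq_iff: "fcode \<phi> = fcode \<psi> \<longleftrightarrow> \<phi> = \<psi>"
proof (induction \<phi> arbitrary: \<psi>)
  case (FEq x y) then show ?case by (cases \<psi>) auto
next
  case (FBetw x y z) then show ?case by (cases \<psi>) auto
next
  case (FPred i x) then show ?case by (cases \<psi>) auto
next
  case (FNot \<phi>) then show ?case by (cases \<psi>) auto
next
  case (FAnd \<phi>1 \<phi>2) then show ?case by (cases \<psi>) auto
next
  case (FEx x \<phi>) then show ?case by (cases \<psi>) auto
qed

lemma inj_mcode: "inj mcode"
  by (auto simp: inj_def mcode_def fcode_eq_iff)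


section \<open>Betweenness\<close>

definition betw :: "'a::metric_space \<Rightarrow> 'a \<Rightarrow> 'a \<Rightarrow> bool" where
  "betw s t u \<longleftrightarrow> dist s u = dist s t + dist t u"

end

theory Submission
  imports Defs
begin

text \<open>In dimension at least 2, betweenness defines parallelism, and with it addition and
  multiplication on the line through the first two points of a frame \<open>o\<close>, \<open>a\<close>, \<open>b\<close>. Since the
  reals are Archimedean, a first-order condition on a set of points forces it to be the copy
  \<open>{o + m (a - o) | m \<in> \<nat>}\<close> of the natural numbers, and the remaining monadic predicates
  restrict to arbitrary sets of numbers. An arithmetical formula thus translates into a
  geometric one over all such frames. Its input \<open>x\<close> enters through a formula defining
  \<open>o + x (a - o)\<close>, obtained by applying a fixed formula constructor \<open>x\<close> times, so that for the
  computability of the reduction only maps \<open>y \<mapsto> prod_encode (c, y)\<close> and their iterates matter.\<close>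

section \<open>Computable functions\<close>

lemma computes_comp1:
  assumes "computes g xs y" "computes f [y] z"
  shows "computes (Rcomp f [g]) xs z"
  using assms by (intro computes.comp[of "[y]"]) auto

lemma computes_comp2:
  assumes "computes g xs y" "computes h xs w" "computes f [y, w] z"
  shows "computes (Rcomp f [g, h]) xs z"
  using assms by (intro computes.comp[of "[y, w]"]) (auto simp: less_Suc_eq)

lemma computes_const: "\<exists>p. \<forall>xs. computes p xs c"
proof (induction c)
  case 0
  show ?case by (meson computes.zero)
next
  case (Suc c)
  then obtain p where "\<And>xs. computes p xs c" by blast
  then have "computes (Rcomp Rsucc [p]) xs (Suc c)" for xs
    by (rule computes_comp1) (rule computes.succ)
  then show ?case by blast
qed

lemma computes_proj0: "computes (Rproj 0) (x # xs) x"
  using computes.proj[of 0 "x # xs"] by simp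

lemma computes_proj1: "computes (Rproj 1) (x # y # xs) y"
  using computes.proj[of 1 "x # y # xs"] by simp

lemma computable_id: "computable (\<lambda>x. x)"
  unfolding computable_def by (meson computes_proj0)

lemma computable_comp:
  assumes "computable f" "computable g"
  shows "computable (\<lambda>x. f (g x))"
  using assms unfolding computable_def by (meson computes_comp1)

text \<open>The step of \<open>Rprec\<close> ignores the counter and applies \<open>h\<close> to the
  previous value, found at position 1.\<close>

lemma computable_funpow:
  assumes "computable h"
  shows "computable (\<lambda>n. (h ^^ n) c)"
proof -
  obtain p where p: "\<And>x. computes p [x] (h x)"
    using assms unfolding computable_def by blast
  obtain q where q: "\<And>xs. computes q xs c"
    using computes_const by blast
  have "computes (Rprec q (Rcomp p [Rproj 1])) [n] ((h ^^ n) c)" for n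
  proof (induction n)
    case 0
    show ?case using q by (auto intro: computes.prec_0)
  next
    case (Suc n)
    then show ?case
      using p by (auto intro!: computes.prec_Suc computes_comp1 computes_proj1[unfolded One_nat_def])
  qed
  then show ?thesis unfolding computable_def by blast
qed

lemma computes_add: "\<exists>p. \<forall>m n. computes p [m, n] (m + n)"
proof -
  have "computes (Rprec (Rproj 0) (Rcomp Rsucc [Rproj 1])) [m, n] (m + n)" for m n
  proof (induction m)
    case 0
    show ?case by (auto intro: computes.prec_0 computes_proj0)
  next
    case (Suc m)
    have "computes (Rcomp Rsucc [Rproj 1]) (m # (m + n) # [n]) (Suc (m + n))"
      by (rule computes_comp1[OF computes_proj1 computes.succ])
    with Suc show ?case by (auto intro: computes.prec_Suc)
  qed
  then show ?thesis by blast
qed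

lemma computable_add_const: "computable (\<lambda>y. c + y)"
proof -
  obtain p q where "\<And>m n. computes p [m, n] (m + n)" "\<And>xs. computes q xs c"
    using computes_add computes_const by metis
  then have "computes (Rcomp p [q, Rproj 0]) [y] (c + y)" for y
    using computes_comp2[OF _ computes_proj0] by blast
  then show ?thesis unfolding computable_def by blast
qed

lemma computable_triangle: "computable triangle"
proof -
  obtain p where p: "\<And>m n. computes p [m, n] (m + n)"
    using computes_add by blast
  let ?s = "Rcomp p [Rproj 1, Rcomp Rsucc [Rproj 0]]"
  have "computes (Rprec Rzero ?s) [n] (triangle n)" for n
  proof (induction n)
    case 0
    show ?case by (auto intro: computes.prec_0 computes.zero)
  next
    case (Suc n)
    have "computes ?s [n, triangle n] (triangle n + Suc n)"
      by (rule computes_comp2[OF computes_proj1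
            computes_comp1[OF computes_proj0 computes.succ] p])
    with Suc show ?case by (auto intro: computes.prec_Suc)
  qed
  then show ?thesis unfolding computable_def by blast
qed

lemma computable_prod_encode:
  assumes "computable f"
  shows "computable (\<lambda>x. prod_encode (c, f x))"
proof -
  have "computable (\<lambda>x. c + triangle (c + f x))"
    by (intro computable_comp[OF computable_add_const] computable_comp[OF computable_triangle]
        assms)
  then show ?thesis by (simp add: prod_encode_def add.commute)
qed


section \<open>Affine geometry in terms of betweenness\<close>

definition coll :: "'a::metric_space \<Rightarrow> 'a \<Rightarrow> 'a \<Rightarrow> bool" where
  "coll x y z \<longleftrightarrow> betw x y z \<or> betw y z x \<or> betw z x y"

lemma coll_iff_collinear:
  fixes x y z :: "'a::euclidean_space"
  shows "coll x y z \<longleftrightarrow> collinear {x, y, z}"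
  unfolding coll_def betw_def collinear_between_cases between
  by (auto simp: dist_commute)

lemma coll_iff:
  fixes x y z :: "'a::euclidean_space"
  shows "coll x y z \<longleftrightarrow> x = y \<or> (\<exists>k. z = x + k *\<^sub>R (y - x))"
proof -
  have "coll x y z \<longleftrightarrow> collinear {y, x, z}"
    by (simp add: coll_iff_collinear insert_commute)
  also have "\<dots> \<longleftrightarrow> collinear {0, y - x, z - x}"
    by (rule collinear_3) (simp add: NO_MATCH_def)
  also have "\<dots> \<longleftrightarrow> y - x = 0 \<or> z - x = 0 \<or> (\<exists>k. z - x = k *\<^sub>R (y - x))"
    by (rule collinear_lemma)
  also have "\<dots> \<longleftrightarrow> x = y \<or> (\<exists>k. z = x + k *\<^sub>R (y - x))"
    by (smt (verit) add.commute diff_add_cancel add_diff_cancel right_minus_eq scale_zero_left)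
  finally show ?thesis .
qed

text \<open>Unequal coefficients of \<open>r - p\<close> could be divided out, putting
  \<open>r\<close> on the line \<open>pq\<close>. This justifies the later comparisons of plane
  coordinates.\<close>

lemma not_coll_independent:
  fixes p q r :: "'a::euclidean_space"
  assumes "\<not> coll p q r"
    and "s *\<^sub>R (q - p) + t *\<^sub>R (r - p) = s' *\<^sub>R (q - p) + t' *\<^sub>R (r - p)"
  shows "s = s' \<and> t = t'"
proof -
  have *: "(t - t') *\<^sub>R (r - p) = (s' - s) *\<^sub>R (q - p)"
    using assms(2) by (simp add: scaleR_left_diff_distrib algebra_simps)
  have "t = t'"
  proof (rule ccontr)
    assume "t \<noteq> t'"
    then have "r - p = ((s' - s) / (t - t')) *\<^sub>R (q - p)"
      using arg_cong[OF *, of "\<lambda>w. (1 / (t - t')) *\<^sub>R w"] by simp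
    then have "r = p + ((s' - s) / (t - t')) *\<^sub>R (q - p)"
      by (simp add: algebra_simps)
    with assms(1) show False unfolding coll_iff by blast
  qed
  moreover have "q \<noteq> p"
    using assms(1) coll_iff by blast
  ultimately show ?thesis using * by simp
qed

text \<open>The vertices in cyclic order are \<open>p\<close>, \<open>q\<close>, \<open>s\<close>,
  \<open>r\<close>. In dimension above 2 disjoint sides could be skew; the meeting diagonals put
  \<open>s\<close> in the plane of the other three points.\<close>

definition pgram :: "'a::metric_space \<Rightarrow> 'a \<Rightarrow> 'a \<Rightarrow> 'a \<Rightarrow> bool" where
  "pgram p q r s \<longleftrightarrow> \<not> coll p q r \<and> (\<exists>m. coll p s m \<and> coll q r m) \<and>
    \<not> (\<exists>x. coll p q x \<and> coll r s x) \<and> \<not> (\<exists>x. coll p r x \<and> coll q s x)"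

lemma pgram_iff:
  fixes p q r s :: "'a::euclidean_space"
  shows "pgram p q r s \<longleftrightarrow> \<not> coll p q r \<and> s - r = q - p"
proof (cases "coll p q r")
  case False
  define u v where "u = q - p" and "v = r - p"
  have q: "q = p + u" and r: "r = p + v" by (auto simp: u_def v_def)
  have ind: "x *\<^sub>R u + y *\<^sub>R v = x' *\<^sub>R u + y' *\<^sub>R v \<Longrightarrow> x = x' \<and> y = y'" for x y x' y'
    using not_coll_independent[OF False] unfolding u_def v_def by blast
  have u0: "u \<noteq> 0" using ind[of 1 0 0 0] by auto
  have v0: "v \<noteq> 0" using ind[of 0 1 0 0] by auto
  have uv: "u \<noteq> v" using ind[of 1 0 0 1] by auto
  show ?thesis
  proof
    assume L: "pgram p q r s"
    then obtain m where m: "coll p s m" "coll q r m" unfolding pgram_def by blast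
    \<comment> \<open>For \<open>p = s\<close> the condition \<open>coll p s m\<close> would be
      void.\<close>
    have "p \<noteq> s"
    proof
      assume "p = s"
      then have "coll p q p \<and> coll r s p"
        by (auto simp: coll_def betw_def)
      with L show False unfolding pgram_def by blast
    qed
    then obtain k where k: "m = p + k *\<^sub>R (s - p)" using m(1) coll_iff by blast
    obtain c where c: "m = q + c *\<^sub>R (r - q)" using m(2) uv unfolding coll_iff q r by auto
    have kc: "k *\<^sub>R (s - p) = (1 - c) *\<^sub>R u + c *\<^sub>R v"
      using k c unfolding q r by (simp add: algebra_simps)
    \<comment> \<open>\<open>k = 0\<close> would place \<open>m = p\<close> on the line
      \<open>qr\<close>.\<close>
    have "k \<noteq> 0" using kc ind[of "1 - c" c 0 0] by auto
    then obtain x y where s: "s = p + (x *\<^sub>R u + y *\<^sub>R v)"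
    proof -
      have "s - p = ((1 - c) / k) *\<^sub>R u + (c / k) *\<^sub>R v"
        using arg_cong[OF kc, of "\<lambda>w. (1 / k) *\<^sub>R w"] \<open>k \<noteq> 0\<close> by (simp add: scaleR_right_distrib)
      then have "s = p + (((1 - c) / k) *\<^sub>R u + (c / k) *\<^sub>R v)" by (simp add: algebra_simps)
      then show ?thesis by (rule that)
    qed
    have "y = 1"
    proof (rule ccontr)
      assume y: "y \<noteq> 1"
      \<comment> \<open>The point \<open>r + l (s - r)\<close> has \<open>v\<close>-coordinate
        \<open>1 - l (1 - y)\<close>, which vanishes for \<open>l = 1 / (1 - y)\<close>: there the
        line \<open>rs\<close> crosses \<open>pq\<close>.\<close>
      define w where "w = p + (x / (1 - y)) *\<^sub>R u"
      have "(1 / (1 - y)) * (1 - y) = 1" using y by simp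
      then have e: "(1 / (1 - y)) *\<^sub>R v - (y / (1 - y)) *\<^sub>R v = v"
        unfolding scaleR_left_diff_distrib[symmetric] using y 
        by (simp add: diff_divide_distrib[symmetric])
      have "coll p q w" unfolding coll_iff w_def q by auto
      moreover have "w = r + (1 / (1 - y)) *\<^sub>R (s - r)"
        using e unfolding w_def r s by (simp add: algebra_simps)
      then have "coll r s w" unfolding coll_iff by blast
      ultimately show False using L unfolding pgram_def by blast
    qed
    moreover have "x = 1"
    proof (rule ccontr)
      assume x: "x \<noteq> 1"
      define w where "w = p + (y / (1 - x)) *\<^sub>R v"
      have e: "(1 / (1 - x)) *\<^sub>R u - (x / (1 - x)) *\<^sub>R u = u"
        unfolding scaleR_left_diff_distrib[symmetric] using x 
        by (simp add: diff_divide_distrib[symmetric])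
      have "coll p r w" unfolding coll_iff w_def r by auto
      moreover have "w = q + (1 / (1 - x)) *\<^sub>R (s - q)"
        using e unfolding w_def q s by (simp add: algebra_simps)
      then have "coll q s w" unfolding coll_iff by blast
      ultimately show False using L unfolding pgram_def by blast
    qed
    ultimately show "\<not> coll p q r \<and> s - r = q - p"
      using False unfolding s q r by simp
  next
    assume "\<not> coll p q r \<and> s - r = q - p"
    then have s: "s = p + u + v" unfolding q r by (simp add: algebra_simps)
    define m where "m = p + (1/2) *\<^sub>R (u + v)"
    have "coll p s m" unfolding coll_iff m_def s by (auto simp: algebra_simps)
    moreover have "m = q + (1/2) *\<^sub>R (r - q)" 
      unfolding m_def q r by (simp add: algebra_simps flip: scaleR_left_distrib)
    then have "coll q r m" unfolding coll_iff by blast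
    moreover have "\<not> (\<exists>x. coll p q x \<and> coll r s x)"
    proof
      assume "\<exists>x. coll p q x \<and> coll r s x"
      then obtain i j where "p + i *\<^sub>R u = r + j *\<^sub>R u"
        unfolding coll_iff q r s using u0 by (auto simp: algebra_simps)
      then show False unfolding r using ind[of i 0 j 1] by (simp add: algebra_simps)
    qed
    moreover have "\<not> (\<exists>x. coll p r x \<and> coll q s x)"
    proof
      assume "\<exists>x. coll p r x \<and> coll q s x"
      then obtain i j where "p + i *\<^sub>R v = q + j *\<^sub>R v"
        unfolding coll_iff q r s using v0 by (auto simp: algebra_simps)
      then show False unfolding q using ind[of 0 i 1 j] by (simp add: algebra_simps)
    qed
    ultimately show "pgram p q r s" using False unfolding pgram_def by blast
  qed
qed (simp add: pgram_def)

lemma exists_not_in_span_singleton: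
  assumes "DIM('a::euclidean_space) \<ge> 2"
  shows "\<exists>v::'a. v \<notin> span {u}"
proof -
  have "dim (span {u}) < DIM('a)"
    using assms dim_le_card'[of "{u}"] by (simp del: dim_singleton)
  then have "span {u} \<noteq> UNIV"
    by (metis dim_UNIV less_irrefl)
  then show ?thesis by auto
qed

lemma exists_not_coll:
  assumes "DIM('a::euclidean_space) \<ge> 2"
  shows "\<exists>x y z::'a. \<not> coll x y z"
proof -
  obtain u :: 'a where u: "u \<in> Basis" using nonempty_Basis by blast
  obtain v where "v \<notin> span {u}"
    using exists_not_in_span_singleton[OF assms] by blast
  then have "\<not> coll 0 u v"
    using u by (auto simp: coll_iff span_singleton)
  then show ?thesis by blast
qed

text \<open>A vector is transported along its own line through an auxiliary parallelogram off that
  line, which exists only in dimension at least 2.\<close>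

lemma equal_vectors_iff_pgram:
  fixes p q r s :: "'a::euclidean_space"
  assumes "DIM('a) \<ge> 2"
  shows "(p = q \<and> r = s) \<or> (\<exists>t w. pgram p q t w \<and> pgram r s t w) \<longleftrightarrow> q - p = s - r"
proof
  assume "(p = q \<and> r = s) \<or> (\<exists>t w. pgram p q t w \<and> pgram r s t w)"
  then show "q - p = s - r" by (auto simp: pgram_iff)
next
  assume eq: "q - p = s - r"
  show "(p = q \<and> r = s) \<or> (\<exists>t w. pgram p q t w \<and> pgram r s t w)"
  proof (cases "p = q")
    case True
    then show ?thesis using eq by simp
  next
    case False
    define u where "u = q - p"
    obtain v where v: "v \<notin> span {u}"
      using exists_not_in_span_singleton[OF assms] by blast
    have ncoll: "\<not> coll x y z" if "y - x = u" "z - x \<notin> span {u}" for x y z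
    proof -
      have "y \<noteq> x" using that False u_def by auto
      then show ?thesis using that unfolding coll_iff by (auto simp: span_singleton)
    qed
    have 1: "(p + i *\<^sub>R v) - p \<notin> span {u}" if "i \<noteq> 0" for i
      using v that span_scale[of "i *\<^sub>R v" "{u}" "1 / i"] by auto
    \<comment> \<open>The auxiliary side must also avoid the parallel to \<open>u\<close> through
      \<open>r\<close>. At most one multiple of \<open>v\<close> leads onto it, so one of two
      candidates works.\<close>
    have "\<exists>i\<in>{1, 2}. (p + i *\<^sub>R v) - r \<notin> span {u}"
    proof (rule ccontr)
      assume "\<not> ?thesis"
      then have "(p + 1 *\<^sub>R v) - r \<in> span {u}" "(p + 2 *\<^sub>R v) - r \<in> span {u}" by auto
      then have "((p + 2 *\<^sub>R v) - r) - ((p + 1 *\<^sub>R v) - r) \<in> span {u}"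
        using span_diff by blast
      moreover have "((p + 2 *\<^sub>R v) - r) - ((p + 1 *\<^sub>R v) - r) = v"
        by (simp add: scaleR_2)
      ultimately have "v \<in> span {u}" by simp
      with v show False ..
    qed
    then obtain i where i: "i \<noteq> 0" "(p + i *\<^sub>R v) - r \<notin> span {u}"
      by (metis insertE singletonD zero_neq_numeral zero_neq_one)
    let ?t = "p + i *\<^sub>R v"
    have "pgram p q ?t (?t + u)" unfolding pgram_iff using ncoll 1 i u_def by auto
    moreover have "pgram r s ?t (?t + u)" unfolding pgram_iff using ncoll i u_def eq by auto
    ultimately show ?thesis by blast
  qed
qed

section \<open>Coordinates on a line\<close>

definition pt :: "'a::real_vector \<Rightarrow> 'a \<Rightarrow> real \<Rightarrow> 'a" where
  "pt x y t = x + t *\<^sub>R (y - x)"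

lemma pt_0 [simp]: "pt x y 0 = x"
  and pt_1 [simp]: "pt x y 1 = y"
  by (simp_all add: pt_def)

lemma pt_eq_iff [simp]: "x \<noteq> y \<Longrightarrow> pt x y s = pt x y t \<longleftrightarrow> s = t"
  by (simp add: pt_def)

lemma pt_add: "pt x y s - x = z - pt x y t \<longleftrightarrow> z = pt x y (s + t)"
  by (auto simp: pt_def algebra_simps)

lemma pt_succ: "y - x = z - pt x y t \<longleftrightarrow> z = pt x y (t + 1)"
  by (auto simp: pt_def algebra_simps)

text \<open>Dividing all distances by \<open>norm (y - x)\<close> leaves
  \<open>t = s + |s - t|\<close>. Betweenness seen from the origin thus serves as the order of the
  natural numbers.\<close>

lemma betw_pt_iff:
  fixes x y :: "'a::real_normed_vector"
  assumes "x \<noteq> y" "s \<ge> 0" "t \<ge> 0"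
  shows "betw x (pt x y s) (pt x y t) \<longleftrightarrow> s \<le> t"
proof -
  have "pt x y s - pt x y t = (s - t) *\<^sub>R (y - x)"
    by (simp add: pt_def algebra_simps)
  then have "betw x (pt x y s) (pt x y t) \<longleftrightarrow>
      t * norm (y - x) = s * norm (y - x) + \<bar>s - t\<bar> * norm (y - x)"
    using assms by (simp add: betw_def dist_norm pt_def)
  also have "\<dots> \<longleftrightarrow> t = s + \<bar>s - t\<bar>"
    using assms by (simp flip: distrib_right)
  finally show ?thesis by auto
qed

text \<open>Distances along the line give \<open>|t| = 1 + |t - 1|\<close>, which fails for all
  \<open>t\<close> below 1.\<close>

lemma betw_imp_pt:
  fixes x y z :: "'a::euclidean_space"
  assumes "x \<noteq> y" "betw x y z"
  shows "\<exists>t\<ge>1. z = pt x y t"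
proof -
  from assms obtain t where t: "z = pt x y t"
    using coll_iff coll_def unfolding pt_def by metis
  have "\<bar>t\<bar> * norm (y - x) = norm (y - x) + \<bar>t - 1\<bar> * norm (y - x)"
  proof -
    have "y - z = (1 - t) *\<^sub>R (y - x)" unfolding t pt_def by (simp add: algebra_simps)
    moreover have "x - z = - (t *\<^sub>R (y - x))" unfolding t pt_def by simp
    ultimately show ?thesis
      using assms(2) unfolding betw_def dist_norm
      by (simp add: norm_minus_commute[of x y] abs_minus_commute)
  qed
  then have "\<bar>t\<bar> = 1 + \<bar>t - 1\<bar>"
    using assms(1) by (metis (no_types, lifting) distrib_right mult_1 mult_right_cancel norm_eq_zero right_minus_eq)
  then show ?thesis using t by (intro exI[of _ t]) auto
qed

text \<open>The parallel to \<open>ab\<close> through the point \<open>y\<close> of the first axis meets the second axis at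
  \<open>q' = y\<close>; by the intercept theorem the parallel through \<open>q'\<close> to the line joining \<open>b\<close> and the
  point \<open>x\<close> of the first axis meets the first axis at \<open>x * y\<close>.\<close>

lemma mult_by_parallels:
  fixes o' a b :: "'a::euclidean_space"
  assumes nc: "\<not> coll o' a b"
  shows "coll o' a r \<and> (\<exists>q'. coll o' b q' \<and> (\<exists>k. q' - pt o' a y = k *\<^sub>R (b - a)) \<and>
      (\<exists>k. r - q' = k *\<^sub>R (pt o' a x - b))) \<longleftrightarrow> r = pt o' a (x * y)" (is "?L \<longleftrightarrow> ?R")
proof -
  define u v where "u = a - o'" and "v = b - o'"
  have a: "a = o' + u" and b: "b = o' + v" by (auto simp: u_def v_def)
  have ind: "i *\<^sub>R u + j *\<^sub>R v = i' *\<^sub>R u + j' *\<^sub>R v \<Longrightarrow> i = i' \<and> j = j'" for i j i' j'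
    using not_coll_independent[OF nc] unfolding u_def v_def by blast
  have v0: "v \<noteq> 0" using ind[of 0 1 0 0] by auto
  show ?thesis
  proof
    assume ?L
    then obtain q' k l where *: "coll o' a r" "coll o' b q'" "q' - pt o' a y = k *\<^sub>R (b - a)"
      "r - q' = l *\<^sub>R (pt o' a x - b)" by blast
    obtain m where m: "q' = o' + m *\<^sub>R v"
      using *(2) v0 unfolding coll_iff b by auto
    have "0 *\<^sub>R u + m *\<^sub>R v = (y - k) *\<^sub>R u + k *\<^sub>R v"
      using *(3) unfolding m a b pt_def by (simp add: algebra_simps)
    from ind[OF this] have my: "m = y" by simp
    have "u \<noteq> 0" using ind[of 1 0 0 0] by auto
    then obtain z where z: "r = o' + z *\<^sub>R u"
      using *(1) unfolding coll_iff a by auto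
    have "z *\<^sub>R u + 0 *\<^sub>R v = (l * x) *\<^sub>R u + (y - l) *\<^sub>R v"
      using *(4) unfolding z m my a b pt_def by (simp add: algebra_simps)
    \<comment> \<open>Here \<open>l = y\<close> and \<open>z = l x\<close>: both parallels are
      scaled by \<open>y\<close>.\<close>
    from ind[OF this] show ?R unfolding z a pt_def by (simp add: mult.commute)
  next
    assume r: ?R
    show ?L
    proof (intro exI[of _ "o' + y *\<^sub>R v"] conjI)
      show "coll o' a r" unfolding coll_iff r pt_def by auto
      show "coll o' b (o' + y *\<^sub>R v)" unfolding coll_iff b by auto
      show "\<exists>k. o' + y *\<^sub>R v - pt o' a y = k *\<^sub>R (b - a)"
        unfolding a b pt_def by (rule exI[of _ y]) (simp add: algebra_simps)
      show "\<exists>k. r - (o' + y *\<^sub>R v) = k *\<^sub>R (pt o' a x - b)"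
        unfolding a b pt_def r by (rule exI[of _ y]) (simp add: algebra_simps)
    qed
  qed
qed


section \<open>Geometric formulas\<close>

text \<open>Variables \<open>0\<close>, \<open>1\<close>, \<open>2\<close> hold a frame \<open>o\<close>, \<open>a\<close>, \<open>b\<close>; \<open>3\<close> to \<open>9\<close> are bound inside the
  formulas below. Predicate \<open>0\<close> holds the natural numbers on the line \<open>oa\<close>.\<close>

definition FOr :: "form \<Rightarrow> form \<Rightarrow> form" where
  "FOr \<phi> \<psi> = FNot (FAnd (FNot \<phi>) (FNot \<psi>))"

definition FAll :: "nat \<Rightarrow> form \<Rightarrow> form" where
  "FAll x \<phi> = FNot (FEx x (FNot \<phi>))"

definition FColl :: "nat \<Rightarrow> nat \<Rightarrow> nat \<Rightarrow> form" where
  "FColl x y z = FOr (FBetw x y z) (FOr (FBetw y z x) (FBetw z x y))"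

definition FPgram :: "nat \<Rightarrow> nat \<Rightarrow> nat \<Rightarrow> nat \<Rightarrow> form" where
  "FPgram p q r s = FAnd (FNot (FColl p q r)) (FAnd (FEx 3 (FAnd (FColl p s 3) (FColl q r 3)))
    (FAnd (FNot (FEx 3 (FAnd (FColl p q 3) (FColl r s 3))))
      (FNot (FEx 3 (FAnd (FColl p r 3) (FColl q s 3))))))"

definition FVec :: "nat \<Rightarrow> nat \<Rightarrow> nat \<Rightarrow> nat \<Rightarrow> form" where
  "FVec p q r s = FOr (FAnd (FEq p q) (FEq r s))
    (FEx 4 (FEx 5 (FAnd (FPgram p q 4 5) (FPgram r s 4 5))))"

text \<open>Variable 6 is \<open>r + (q - p)\<close>. Transporting the vector, instead of asking for
  disjoint lines, admits \<open>p = q\<close>, which occurs in \<open>FMult\<close> when the second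
  factor is 0.\<close>

definition FPar :: "nat \<Rightarrow> nat \<Rightarrow> nat \<Rightarrow> nat \<Rightarrow> form" where
  "FPar p q r s = FEx 6 (FAnd (FVec p q r 6) (FColl r s 6))"

definition FMult :: "nat \<Rightarrow> nat \<Rightarrow> nat \<Rightarrow> form" where
  "FMult p q r = FAnd (FColl 0 1 r)
    (FEx 7 (FAnd (FColl 0 2 7) (FAnd (FPar q 7 1 2) (FPar 7 r 2 p))))"

definition FNats :: form where
  "FNats = FAnd (FPred 0 0)
    (FAnd (FAll 8 (FAll 9 (FOr (FNot (FPred 0 8)) (FOr (FNot (FVec 0 1 8 9)) (FPred 0 9)))))
      (FAll 8 (FOr (FNot (FPred 0 8)) (FOr (FEq 8 0)
        (FAnd (FBetw 0 1 8) (FEx 9 (FAnd (FPred 0 9) (FVec 0 1 9 8))))))))"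

lemma fsat_FOr [simp]: "fsat R X e (FOr \<phi> \<psi>) \<longleftrightarrow> fsat R X e \<phi> \<or> fsat R X e \<psi>"
  by (simp add: FOr_def)

lemma fsat_FAll [simp]: "fsat R X e (FAll x \<phi>) \<longleftrightarrow> (\<forall>a. fsat R X (e(x := a)) \<phi>)"
  by (simp add: FAll_def)

lemma fsat_FColl [simp]: "fsat betw X e (FColl x y z) \<longleftrightarrow> coll (e x) (e y) (e z)"
  by (simp add: FColl_def coll_def)

lemma fsat_FPgram:
  assumes "3 \<notin> {p, q, r, s}"
  shows "fsat betw X e (FPgram p q r s) \<longleftrightarrow> pgram (e p) (e q) (e r) (e s)"
  using assms by (simp add: FPgram_def pgram_def)

lemma fsat_FVec [simp]:
  fixes e :: "nat \<Rightarrow> 'a::euclidean_space"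
  assumes "DIM('a) \<ge> 2" "{3, 4, 5} \<inter> {p, q, r, s} = {}"
  shows "fsat betw X e (FVec p q r s) \<longleftrightarrow> e q - e p = e s - e r"
  using assms(2) equal_vectors_iff_pgram[OF assms(1), of "e p" "e q" "e r" "e s"]
  by (simp add: FVec_def fsat_FPgram)

text \<open>For \<open>e r = e s\<close> every point would satisfy \<open>FColl r s 6\<close>, hence
  the last assumption.\<close>

lemma fsat_FPar [simp]:
  fixes e :: "nat \<Rightarrow> 'a::euclidean_space"
  assumes "DIM('a) \<ge> 2" "{3, 4, 5, 6} \<inter> {p, q, r, s} = {}" "e r \<noteq> e s"
  shows "fsat betw X e (FPar p q r s) \<longleftrightarrow> (\<exists>k. e q - e p = k *\<^sub>R (e s - e r))"
proof -
  have "fsat betw X e (FPar p q r s) \<longleftrightarrow>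
      (\<exists>d. e q - e p = d - e r \<and> (\<exists>k. d = e r + k *\<^sub>R (e s - e r)))"
    using assms by (simp add: FPar_def coll_iff)
  moreover have "e q - e p = d - e r \<and> d = e r + k *\<^sub>R (e s - e r) \<longleftrightarrow>
      d = e r + k *\<^sub>R (e s - e r) \<and> e q - e p = k *\<^sub>R (e s - e r)" for d k
    by auto
  ultimately show ?thesis by metis
qed

lemma fsat_FMult:
  fixes e :: "nat \<Rightarrow> 'a::euclidean_space"
  assumes dim: "DIM('a) \<ge> 2" and nc: "\<not> coll (e 0) (e 1) (e 2)"
    and fresh: "{3, 4, 5, 6, 7} \<inter> {p, q, r} = {}"
    and p: "e p = pt (e 0) (e 1) x" and q: "e q = pt (e 0) (e 1) y"
  shows "fsat betw X e (FMult p q r) \<longleftrightarrow> e r = pt (e 0) (e 1) (x * y)"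
proof -
  \<comment> \<open>Both directions passed to \<open>FPar\<close> are nonzero because
    \<open>b\<close> lies off the axis through \<open>a\<close> and \<open>e p\<close>.\<close>
  have "e 1 \<noteq> e 2"
    using nc by (auto simp: coll_def betw_def)
  moreover have "e 2 \<noteq> e p"
    using nc p unfolding coll_iff_collinear pt_def
    by (metis coll_iff coll_iff_collinear)
  ultimately show ?thesis
    using fresh dim unfolding mult_by_parallels[OF nc, symmetric] p[symmetric] q[symmetric]
    by (simp add: FMult_def)
qed

text \<open>Closure under successor and predecessor together with the gap between \<open>0\<close> and \<open>1\<close> suffice:
  no induction axiom is needed because the reals are Archimedean.\<close>

lemma fsat_FNats:
  fixes e :: "nat \<Rightarrow> 'a::euclidean_space"
  assumes dim: "DIM('a) \<ge> 2" and ne: "e 0 \<noteq> e 1"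
  shows "fsat betw X e FNats \<longleftrightarrow> X 0 = range (\<lambda>m::nat. pt (e 0) (e 1) (real m))"
proof -
  let ?pt = "pt (e 0) (e 1)"
  have "fsat betw X e FNats \<longleftrightarrow> e 0 \<in> X 0 \<and>
      (\<forall>x y. x \<in> X 0 \<longrightarrow> e 1 - e 0 = y - x \<longrightarrow> y \<in> X 0) \<and>
      (\<forall>x. x \<in> X 0 \<longrightarrow> x = e 0 \<or> betw (e 0) (e 1) x \<and> (\<exists>y. y \<in> X 0 \<and> e 1 - e 0 = x - y))"
    (is "_ \<longleftrightarrow> ?A \<and> ?B \<and> ?C")
    using dim by (auto simp: FNats_def)
  also have "\<dots> \<longleftrightarrow> X 0 = range (\<lambda>m::nat. ?pt (real m))"
  proof
    assume *: "?A \<and> ?B \<and> ?C"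
    have "?pt (real m) \<in> X 0" for m :: nat
    proof (induction m)
      case 0
      show ?case using * by simp
    next
      case (Suc m)
      have "e 1 - e 0 = ?pt (real (Suc m)) - ?pt (real m)"
        by (simp add: pt_succ add.commute)
      with Suc * show ?case by blast
    qed
    \<comment> \<open>Predecessors are taken until the origin is reached, by induction on a natural
      bound \<open>k\<close> of the coordinate. In the base case \<open>t\<close> is negative,
      whereas members other than the origin have coordinate at least 1.\<close>
    moreover have "\<exists>m::nat. ?pt t = ?pt (real m)" if "?pt t \<in> X 0" "t < real k" for t k
      using that
    proof (induction k arbitrary: t)
      case 0
      then have "?pt t \<noteq> e 0"
        using ne pt_eq_iff[of "e 0" "e 1" t 0] by simp
      then have "betw (e 0) (e 1) (?pt t)" using 0 * by blast
      then obtain s where "s \<ge> 1" "?pt t = ?pt s"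
        using betw_imp_pt[OF ne] by blast
      with 0 show ?case using ne by simp
    next
      case (Suc k)
      show ?case
      proof (cases "?pt t = e 0")
        case True
        then show ?thesis by (intro exI[of _ 0]) simp
      next
        case False
        then obtain y where y: "y \<in> X 0" "e 1 - e 0 = ?pt t - y" using Suc.prems * by blast
        have y': "y = ?pt (t - 1)"
          using y(2) by (simp add: pt_def algebra_simps)
        then obtain m :: nat where "?pt (t - 1) = ?pt (real m)"
          using Suc.IH[of "t - 1"] Suc.prems y by auto
        then have "t = real (Suc m)" using ne by simp
        then show ?thesis by blast
      qed
    qed
    moreover have "\<exists>t. x = ?pt t" if "x \<in> X 0" for x
    proof (cases "x = e 0")
      case True
      then show ?thesis by (intro exI[of _ 0]) simp
    next
      case False
      then show ?thesis using that * betw_imp_pt[OF ne] by blast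
    qed
    ultimately have "x \<in> X 0 \<longleftrightarrow> (\<exists>m::nat. x = ?pt (real m))" for x
      using reals_Archimedean2 by metis
    then show "X 0 = range (\<lambda>m::nat. ?pt (real m))"
      by blast
  next
    assume X: "X 0 = range (\<lambda>m::nat. ?pt (real m))"
    have ?A unfolding X by (rule image_eqI[of _ _ 0]) simp_all
    moreover have ?B
    proof (intro allI impI)
      fix x y assume "x \<in> X 0" "e 1 - e 0 = y - x"
      then obtain m :: nat where "y = ?pt (real m + 1)" unfolding X by (auto simp: pt_succ)
      then show "y \<in> X 0" unfolding X by (intro image_eqI[of _ _ "Suc m"]) (simp_all add: add.commute)
    qed
    moreover have ?C
    proof (intro allI impI)
      fix x assume "x \<in> X 0"
      then obtain m :: nat where m: "x = ?pt (real m)" unfolding X by blast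
      show "x = e 0 \<or> betw (e 0) (e 1) x \<and> (\<exists>y. y \<in> X 0 \<and> e 1 - e 0 = x - y)"
      proof (cases m)
        case 0
        then show ?thesis using m by simp
      next
        case (Suc l)
        have "betw (e 0) (e 1) x"
          using betw_pt_iff[OF ne, of 1 "real m"] Suc m by simp
        moreover have "e 1 - e 0 = x - ?pt (real l)"
          using Suc m by (simp add: pt_succ add.commute)
        ultimately show ?thesis unfolding X by blast
      qed
    qed
    ultimately show "?A \<and> ?B \<and> ?C" by blast
  qed
  finally show ?thesis .
qed


section \<open>Interpretation of second-order arithmetic\<close>

text \<open>Number variables become even first-order variables and the values of subterms odd ones, all
  above \<open>9\<close>. In \<open>tterm t i k\<close>, the variable \<open>tv i\<close> holds the value of \<open>t\<close>, and the \<open>tv j\<close> with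
  \<open>j \<ge> k\<close> are fresh.\<close>

definition nv :: "nat \<Rightarrow> nat" where
  "nv x = 2 * x + 10"

definition tv :: "nat \<Rightarrow> nat" where
  "tv k = 2 * k + 11"

lemma nv_neq [simp]: "nv x \<noteq> tv k" "tv k \<noteq> nv x"
  unfolding nv_def tv_def by presburger+

lemma nv_eq_iff [simp]: "nv x = nv y \<longleftrightarrow> x = y"
  and tv_eq_iff [simp]: "tv i = tv k \<longleftrightarrow> i = k"
  by (auto simp: nv_def tv_def)

lemma nv_ge: "nv x > 9" "tv x > 9"
  by (auto simp: nv_def tv_def)

lemma small_neq_nv [simp]: "m < 10 \<Longrightarrow> m \<noteq> nv x" "m < 10 \<Longrightarrow> m \<noteq> tv x"
  "m < 10 \<Longrightarrow> nv x \<noteq> m" "m < 10 \<Longrightarrow> tv x \<noteq> m"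
  using nv_ge[of x] by auto

primrec tterm :: "aterm \<Rightarrow> nat \<Rightarrow> nat \<Rightarrow> form" where
  "tterm (AVar x) i k = FEq (tv i) (nv x)"
| "tterm AZero i k = FEq (tv i) 0"
| "tterm AOne i k = FEq (tv i) 1"
| "tterm (APlus s t) i k = FEx (tv k) (FEx (tv (Suc k)) (FAnd (tterm s k (k + 2))
    (FAnd (tterm t (Suc k) (k + 2)) (FVec 0 (tv k) (tv (Suc k)) (tv i)))))"
| "tterm (ATimes s t) i k = FEx (tv k) (FEx (tv (Suc k)) (FAnd (tterm s k (k + 2))
    (FAnd (tterm t (Suc k) (k + 2)) (FMult (tv k) (tv (Suc k)) (tv i)))))"

text \<open>Predicate 0 is reserved for the natural numbers, so set variables are shifted by one.
  \<open>FBetw\<close> from the origin only expresses \<open>\<le>\<close>; \<open>ALess\<close>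
  therefore adds an inequality.\<close>

primrec tform :: "aform \<Rightarrow> form" where
  "tform (AEq s t) = FEx (tv 0) (FAnd (tterm s 0 1) (tterm t 0 1))"
| "tform (ALess s t) = FEx (tv 0) (FEx (tv 1) (FAnd (tterm s 0 2) (FAnd (tterm t 1 2)
    (FAnd (FNot (FEq (tv 0) (tv 1))) (FBetw 0 (tv 0) (tv 1))))))"
| "tform (AIn t i) = FEx (tv 0) (FAnd (tterm t 0 1) (FPred (Suc i) (tv 0)))"
| "tform (ANot \<phi>) = FNot (tform \<phi>)"
| "tform (AAnd \<phi> \<psi>) = FAnd (tform \<phi>) (tform \<psi>)"
| "tform (AEx x \<phi>) = FEx (nv x) (FAnd (FPred 0 (nv x)) (tform \<phi>))"

text \<open>By \<open>i < k\<close> the result variable is not captured by the quantifiers over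
  \<open>tv k\<close> and above. These need no relativisation to predicate 0, since the formulas of
  the subterms fix their witnesses.\<close>

lemma fsat_tterm:
  fixes e :: "nat \<Rightarrow> 'a::euclidean_space"
  assumes dim: "DIM('a) \<ge> 2"
  shows "\<not> coll (e 0) (e 1) (e 2) \<Longrightarrow> i < k \<Longrightarrow>
    (\<And>x. x \<in> atvars t \<Longrightarrow> e (nv x) = pt (e 0) (e 1) (real (\<epsilon> x))) \<Longrightarrow>
    fsat betw X e (tterm t i k) \<longleftrightarrow> e (tv i) = pt (e 0) (e 1) (real (aval \<epsilon> t))"
proof (induction t arbitrary: e i k)
  case (APlus s t)
  let ?e = "\<lambda>c d. e(tv k := c, tv (Suc k) := d)"
  have "fsat betw X (?e c d) (tterm s k (k + 2)) \<longleftrightarrow> c = pt (e 0) (e 1) (real (aval \<epsilon> s))"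
    "fsat betw X (?e c d) (tterm t (Suc k) (k + 2)) \<longleftrightarrow> d = pt (e 0) (e 1) (real (aval \<epsilon> t))"
    for c d
    using APlus.prems by (subst APlus.IH; simp)+
  then show ?case
    using APlus.prems dim by (simp add: pt_add)
next
  case (ATimes s t)
  let ?e = "\<lambda>c d. e(tv k := c, tv (Suc k) := d)"
  have "fsat betw X (?e c d) (tterm s k (k + 2)) \<longleftrightarrow> c = pt (e 0) (e 1) (real (aval \<epsilon> s))"
    "fsat betw X (?e c d) (tterm t (Suc k) (k + 2)) \<longleftrightarrow> d = pt (e 0) (e 1) (real (aval \<epsilon> t))"
    for c d
    using ATimes.prems by (subst ATimes.IH; simp)+
  \<comment> \<open>\<open>fsat_FMult\<close> requires factors of known coordinate; the other two
    conjuncts supply them, whence \<open>conj_cong\<close>.\<close>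
  moreover have "fsat betw X (?e c d) (FMult (tv k) (tv (Suc k)) (tv i)) \<longleftrightarrow>
      e (tv i) = pt (e 0) (e 1) (real (aval \<epsilon> s) * real (aval \<epsilon> t))"
    if "c = pt (e 0) (e 1) (real (aval \<epsilon> s))" "d = pt (e 0) (e 1) (real (aval \<epsilon> t))" for c d
    using ATimes.prems dim that
    by (subst fsat_FMult[where x = "real (aval \<epsilon> s)" and y = "real (aval \<epsilon> t)"]) simp_all
  ultimately show ?case
    by (simp cong: conj_cong)
qed simp_all

text \<open>Number variables range over predicate 0, so a further predicate matters only through its
  trace on the points with natural coordinate, read as a set of numbers.\<close>

lemma fsat_tform:
  fixes e :: "nat \<Rightarrow> 'a::euclidean_space"
  assumes dim: "DIM('a) \<ge> 2"
  shows "\<not> coll (e 0) (e 1) (e 2) \<Longrightarrow>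
    X 0 = range (\<lambda>m::nat. pt (e 0) (e 1) (real m)) \<Longrightarrow>
    (\<And>x. x \<in> afree \<phi> \<Longrightarrow> e (nv x) = pt (e 0) (e 1) (real (\<epsilon> x))) \<Longrightarrow>
    fsat betw X e (tform \<phi>) \<longleftrightarrow> asat (\<lambda>i. {m. pt (e 0) (e 1) (real m) \<in> X (Suc i)}) \<epsilon> \<phi>"
proof (induction \<phi> arbitrary: e \<epsilon>)
  case (AEq s t)
  have ne: "e 0 \<noteq> e 1" using AEq.prems(1) coll_iff by blast
  have "fsat betw X (e(tv 0 := c)) (tterm s 0 1) \<longleftrightarrow> c = pt (e 0) (e 1) (real (aval \<epsilon> s))"
    "fsat betw X (e(tv 0 := c)) (tterm t 0 1) \<longleftrightarrow> c = pt (e 0) (e 1) (real (aval \<epsilon> t))" for c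
    using AEq.prems by (subst fsat_tterm[OF dim]; simp)+
  then show ?case using ne by simp
next
  case (ALess s t)
  have ne: "e 0 \<noteq> e 1" using ALess.prems(1) coll_iff by blast
  let ?e = "\<lambda>c d. e(tv 0 := c, tv 1 := d)"
  have "fsat betw X (?e c d) (tterm s 0 2) \<longleftrightarrow> c = pt (e 0) (e 1) (real (aval \<epsilon> s))"
    "fsat betw X (?e c d) (tterm t 1 2) \<longleftrightarrow> d = pt (e 0) (e 1) (real (aval \<epsilon> t))" for c d
    using ALess.prems by (subst fsat_tterm[OF dim]; simp)+
  then show ?case using ne by (auto simp: betw_pt_iff)
next
  case (AIn t i)
  have "fsat betw X (e(tv 0 := c)) (tterm t 0 1) \<longleftrightarrow> c = pt (e 0) (e 1) (real (aval \<epsilon> t))" for c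
    using AIn.prems by (subst fsat_tterm[OF dim]; simp)
  then show ?case by simp
next
  case (ANot \<phi>)
  then show ?case by simp
next
  case (AAnd \<phi> \<psi>)
  then show ?case by simp
next
  case (AEx x \<phi>)
  have "fsat betw X (e(nv x := pt (e 0) (e 1) (real m))) (tform \<phi>) \<longleftrightarrow>
      asat (\<lambda>i. {m. pt (e 0) (e 1) (real m) \<in> X (Suc i)}) (\<epsilon>(x := m)) \<phi>" for m
    using AEx.prems by (subst AEx.IH[where \<epsilon> = "\<epsilon>(x := m)"]) auto
  then show ?case using AEx.prems(2) by auto
qed

section \<open>Numerals\<close>

text \<open>Copying the predecessor from variable 8 back into \<open>nv 0\<close> lets all stages
  share their variables. With the recursive formula in last place, codes arise by iterating pairings
  with constants.\<close>

primrec FNum :: "nat \<Rightarrow> form" where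
  "FNum 0 = FEq (nv 0) 0"
| "FNum (Suc n) = FEx 8 (FAnd (FVec 0 1 8 (nv 0)) (FEx (nv 0) (FAnd (FEq (nv 0) 8) (FNum n))))"

lemma fsat_FNum:
  fixes e :: "nat \<Rightarrow> 'a::euclidean_space"
  assumes dim: "DIM('a) \<ge> 2"
  shows "fsat betw X e (FNum n) \<longleftrightarrow> e (nv 0) = pt (e 0) (e 1) (real n)"
proof (induction n arbitrary: e)
  case (Suc n)
  then show ?case using dim by (simp add: pt_succ add.commute)
qed simp

lemma computable_FNum: "computable (\<lambda>n. fcode (FNum n))"
proof -
  \<comment> \<open>\<open>h\<close> is one successor stage acting on codes; 5 and 4 are the tags of
    \<open>FEx\<close> and \<open>FAnd\<close>.\<close>
  define h where "h = (\<lambda>y. prod_encode (5, prod_encode (8, prod_encode (4,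
    prod_encode (fcode (FVec 0 1 8 (nv 0)), prod_encode (5, prod_encode (nv 0,
      prod_encode (4, prod_encode (fcode (FEq (nv 0) 8), y)))))))))"
  have "fcode (FNum n) = (h ^^ n) (fcode (FEq (nv 0) 0))" for n
    by (induction n) (simp_all add: h_def)
  moreover have "computable h"
    unfolding h_def by (intro computable_prod_encode computable_id)
  ultimately show ?thesis
    using computable_funpow by simp
qed

text \<open>This bounds the free variables independently of the input; \<open>FNum 0\<close> would
  miss variable 1.\<close>

lemma ffree_FNum: "ffree (FNum n) \<subseteq> ffree (FNum 1)"
proof (induction n)
  case 0
  have "{0, nv 0} \<subseteq> ffree (FVec 0 1 8 (nv 0))"
    by (simp add: FVec_def FOr_def)
  then show ?case by auto
qed auto

lemma fpreds_FNum: "fpreds (FNum n) = {}"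
proof -
  have "fpreds (FVec 0 1 8 (nv 0)) = {}"
    by (simp add: FVec_def FPgram_def FOr_def FColl_def)
  then show ?thesis by (induction n) simp_all
qed

section \<open>Universal closure\<close>

text \<open>All variables below a fixed \<open>n\<close> are quantified, occurring or not, so the
  reduction need not compute free variables.\<close>

primrec fclose :: "nat \<Rightarrow> form \<Rightarrow> form" where
  "fclose 0 \<phi> = \<phi>"
| "fclose (Suc n) \<phi> = FNot (FEx n (FNot (fclose n \<phi>)))"

lemma ffree_fclose: "ffree (fclose n \<phi>) = ffree \<phi> - {..<n}"
proof (induction n)
  case 0
  show ?case unfolding fclose.simps lessThan_0 Diff_empty ..
next
  case (Suc n)
  show ?case unfolding fclose.simps ffree.simps Suc lessThan_Suc by blast
qed

lemma fpreds_fclose [simp]: "fpreds (fclose n \<phi>) = fpreds \<phi>"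
  by (induction n) auto

lemma fsat_all_fun_upd: "(\<forall>e a. fsat R X (e(x := a)) \<phi>) \<longleftrightarrow> (\<forall>e. fsat R X e \<phi>)"
proof
  assume *: "\<forall>e a. fsat R X (e(x := a)) \<phi>"
  show "\<forall>e. fsat R X e \<phi>"
  proof
    show "fsat R X e \<phi>" for e
      using *[rule_format, of e "e x"] unfolding fun_upd_triv .
  qed
next
  assume "\<forall>e. fsat R X e \<phi>"
  then show "\<forall>e a. fsat R X (e(x := a)) \<phi>" by simp
qed

lemma fsat_fclose: "(\<forall>e. fsat R X e (fclose n \<phi>)) \<longleftrightarrow> (\<forall>e. fsat R X e \<phi>)"
proof (induction n)
  case (Suc n)
  have "(\<forall>e. fsat R X e (fclose (Suc n) \<phi>)) \<longleftrightarrow> (\<forall>e a. fsat R X (e(n := a)) (fclose n \<phi>))"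
    unfolding fclose.simps fsat.simps not_ex not_not ..
  then show ?case unfolding fsat_all_fun_upd Suc .
qed simp

lemma computable_fclose:
  assumes "computable (\<lambda>x. fcode (\<psi> x))"
  shows "computable (\<lambda>x. fcode (fclose n (\<psi> x)))"
  using assms by (induction n) (simp_all add: computable_prod_encode)

lemma finite_ffree: "finite (ffree \<phi>)"
  by (induction \<phi>) auto

lemma finite_fpreds: "finite (fpreds \<phi>)"
  by (induction \<phi>) auto

section \<open>The reduction\<close>

text \<open>Every frame satisfying the premises yields a family of sets of numbers; conversely, a
  single frame realises every family \<open>S\<close> by sets of points on its first axis.\<close>

lemma Pi11_iff_betw:
  assumes dim: "DIM('a::euclidean_space) \<ge> 2" and free: "afree \<phi> \<subseteq> {0}"
  shows "(\<forall>S. asat S (\<lambda>_. x) \<phi>) \<longleftrightarrow> (\<forall>X (e :: nat \<Rightarrow> 'a).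
    fsat betw X e (FNot (FColl 0 1 2)) \<and> fsat betw X e FNats \<and> fsat betw X e (FNum x) \<longrightarrow>
    fsat betw X e (tform \<phi>))" (is "?L \<longleftrightarrow> ?R")
proof
  assume L: ?L
  show ?R
  proof (intro allI impI)
    fix X and e :: "nat \<Rightarrow> 'a"
    assume *: "fsat betw X e (FNot (FColl 0 1 2)) \<and> fsat betw X e FNats \<and> fsat betw X e (FNum x)"
    then have nc: "\<not> coll (e 0) (e 1) (e 2)" by simp
    then have "e 0 \<noteq> e 1" using coll_iff by blast
    with * have "X 0 = range (\<lambda>m::nat. pt (e 0) (e 1) (real m))"
      "e (nv 0) = pt (e 0) (e 1) (real x)"
      using fsat_FNats[OF dim] fsat_FNum[OF dim] by auto
    then show "fsat betw X e (tform \<phi>)"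
      using L fsat_tform[OF dim nc, of X \<phi> "\<lambda>_. x"] free by auto
  qed
next
  assume R: ?R
  show ?L
  proof
    fix S
    obtain p q r :: 'a where nc: "\<not> coll p q r" using exists_not_coll[OF dim] by blast
    then have ne: "p \<noteq> q" using coll_iff by blast
    \<comment> \<open>The default value \<open>p\<close> also serves variable 0, the origin.\<close>
    define e :: "nat \<Rightarrow> 'a" where
      "e = (\<lambda>_. p)(1 := q, 2 := r, nv 0 := pt p q (real x))"
    define X where "X i = (\<lambda>m::nat. pt p q (real m)) ` (case i of 0 \<Rightarrow> UNIV | Suc j \<Rightarrow> S j)" for i
    have e: "e 0 = p" "e 1 = q" "e 2 = r" "e (nv 0) = pt p q (real x)"
      by (simp_all add: e_def)
    have X: "X 0 = range (\<lambda>m::nat. pt (e 0) (e 1) (real m))"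
      unfolding e by (simp add: X_def)
    have "fsat betw X e (FNot (FColl 0 1 2))"
      using nc by (simp add: e del: One_nat_def)
    moreover have "fsat betw X e FNats"
      using fsat_FNats[OF dim, of e X] X ne e by metis
    moreover have "fsat betw X e (FNum x)"
      using fsat_FNum[OF dim, of X e x] e by metis
    ultimately have "fsat betw X e (tform \<phi>)"
      using R by blast
    moreover have "e (nv y) = pt (e 0) (e 1) (real x)" if "y \<in> afree \<phi>" for y
      using that free e by auto
    ultimately have "asat (\<lambda>i. {m. pt (e 0) (e 1) (real m) \<in> X (Suc i)}) (\<lambda>_. x) \<phi>"
      using fsat_tform[OF dim, of e X \<phi> "\<lambda>_. x"] X nc unfolding e by blast
    then have "asat (\<lambda>i. {m. pt p q (real m) \<in> X (Suc i)}) (\<lambda>_. x) \<phi>"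
      unfolding e .
    moreover have "{m. pt p q (real m) \<in> X (Suc i)} = S i" for i
      using ne by (auto simp: X_def)
    ultimately show "asat S (\<lambda>_. x) \<phi>" by simp
  qed
qed

lemma Pi11_hard_betw:
  assumes dim: "DIM('a::euclidean_space) \<ge> 2"
  shows "Pi11_hard (mcode ` mpi11_theory (betw :: 'a \<Rightarrow> 'a \<Rightarrow> 'a \<Rightarrow> bool))"
  unfolding Pi11_hard_def
proof (intro allI impI)
  fix A assume "Pi11_set A"
  then obtain \<phi> where free: "afree \<phi> \<subseteq> {0}" and A: "A = {x. \<forall>S. asat S (\<lambda>_. x) \<phi>}"
    unfolding Pi11_set_def by blast
  define \<beta> where "\<beta> = FAnd (FNot (FColl 0 1 2)) (FAnd FNats (FNot (tform \<phi>)))"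
  \<comment> \<open>The implication of \<open>Pi11_iff_betw\<close> as a negated conjunction, with
    the only part depending on \<open>x\<close> in last place for the sake of its code.\<close>
  define \<psi> where "\<psi> x = FNot (FAnd \<beta> (FNum x))" for x
  \<comment> \<open>The bounds \<open>n\<close> and \<open>k\<close> come from formulas without
    \<open>x\<close>, so they are constants of the reduction.\<close>
  have "finite (ffree \<beta> \<union> ffree (FNum 1))" by (simp add: finite_ffree del: FNum.simps)
  then obtain n where n: "ffree \<beta> \<union> ffree (FNum 1) \<subseteq> {..<n}"
    using finite_nat_iff_bounded by blast
  obtain k where k: "fpreds \<beta> \<subseteq> {..<k}"
    using finite_fpreds finite_nat_iff_bounded by blast
  define f where "f x = mcode (k, fclose n (\<psi> x))" for x
  have "computable (\<lambda>x. fcode (\<psi> x))"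
    by (simp add: \<psi>_def computable_prod_encode computable_FNum)
  then have "computable f"
    unfolding f_def mcode_def by (simp add: computable_prod_encode computable_fclose)
  moreover have "x \<in> A \<longleftrightarrow> f x \<in> mcode ` mpi11_theory (betw :: 'a \<Rightarrow> 'a \<Rightarrow> 'a \<Rightarrow> bool)" for x
  proof -
    have "ffree (\<psi> x) \<subseteq> {..<n}"
      using n ffree_FNum[of x] by (auto simp: \<psi>_def)
    then have "mpi11_sentence (k, fclose n (\<psi> x))"
      using k by (simp add: mpi11_sentence_def ffree_fclose \<psi>_def fpreds_FNum)
    then have "f x \<in> mcode ` mpi11_theory (betw :: 'a \<Rightarrow> 'a \<Rightarrow> 'a \<Rightarrow> bool) \<longleftrightarrow>
        (\<forall>X (e :: nat \<Rightarrow> 'a). fsat betw X e (\<psi> x))"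
      by (simp add: f_def inj_image_mem_iff[OF inj_mcode] mpi11_theory_def mtrue_def fsat_fclose)
    also have "\<dots> \<longleftrightarrow> x \<in> A"
      unfolding A mem_Collect_eq Pi11_iff_betw[OF dim free] \<psi>_def \<beta>_def by auto
    finally show ?thesis ..
  qed
  ultimately show "many_one_reducible A (mcode ` mpi11_theory (betw :: 'a \<Rightarrow> 'a \<Rightarrow> 'a \<Rightarrow> bool))"
    unfolding many_one_reducible_def by blast
qed

theorem theorem7:
  assumes "CARD('n::finite) \<ge> 2"
  shows "Pi11_hard (mcode ` mpi11_theory (betw :: real ^ 'n \<Rightarrow> real ^ 'n \<Rightarrow> real ^ 'n \<Rightarrow> bool))"
  using assms by (intro Pi11_hard_betw) simp

end
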